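(* Let $g_1,\dots,g_r>1$ be integers and let $\mathbb{S}=\{g_1^{i_1}g_2^{i_2}\cdots g_r^{i_r}\mid i_1,\dots,i_r\in\mathbb{N}\cup\{0\}\}$ be the multiplicatively closed set they generate. Suppose that the corresponding points $[g_1],\dots,[g_r]\in\mathbb{PF}^{\infty}_{\mathbb{Q}_{\ge0}}\subset\mathbb{PF}^{\infty}_{\mathbb{Q}}$ lie on a projective line $L$ obtained by joining two (distinct) points of $\mathbb{PF}^{\infty}_{\mathbb{Q}_{\ge0}}$ whose corresponding integers are relatively prime. Then $\mathbb{S}$ is contained in a doubly generated multiplicatively closed set, i.e. in a set of the form $\{u^iv^j\mid i,j\in\mathbb{N}\cup\{0\}\}$ with $u,v$ positive integers.
   Context: $\mathbb{PF}^{\infty}_{\mathbb{Q}}$ is the projective space of the $\mathbb{Q}$-vector space $\bigoplus_{i\ge1}\mathbb{Q}$ (nonzero finitely supported rational sequences modulo multiplication by nonzero rationals). $\mathbb{PF}^{\infty}_{\mathbb{Q}_{\ge0}}\subset\mathbb{PF}^{\infty}_{\mathbb{Q}}$ is the subset of points having a representative with all coordinates non-negative. Coordinates are indexed by the primes $p_1=2,p_2=3,p_3=5,\dots$ in increasing order. For an integer $g>1$ with prime factorization $g=\prod_i p_i^{r_i}$, $[g]$ denotes the point $[r_1:r_2:\ldots]$. Conversely, the integer corresponding to a point $P\in\mathbb{PF}^{\infty}_{\mathbb{Q}_{\ge0}}$ is $f=\prod_i p_i^{r_i}$ where $(r_i)$ is the unique representative of $P$ with non-negative integer coordinates of gcd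 equal to $1$. The projective line joining two distinct points is the set of points of $\mathbb{PF}^{\infty}_{\mathbb{Q}}$ represented by nonzero vectors of the 2-dimensional $\mathbb{Q}$-subspace spanned by representatives of the two points. *)

theory Defs
  imports Complex_Main
    "HOL-Computational_Algebra.Primes"
    "HOL-Library.Infinite_Set"
    "HOL-Library.Poly_Mapping"
begin

text \<open>
  The \<open>\<rat>\<close>-vector space of finitely supported rational sequences is \<^typ>\<open>nat \<Rightarrow>\<^sub>0 rat\<close>.
  Sequences are indexed from \<open>0\<close>: coordinate \<open>i\<close> belongs to the prime
  \<open>nth_prime i\<close>, so that \<open>nth_prime 0 = 2\<close>, \<open>nth_prime 1 = 3\<close>, and so on.
\<close>

type_synonym qseq = "nat \<Rightarrow>\<^sub>0 rat"

definition nth_prime :: "nat \<Rightarrow> nat" where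
  "nth_prime = enumerate {p. prime p}"

lift_definition qscale :: "rat \<Rightarrow> qseq \<Rightarrow> qseq" is "\<lambda>c v i. c * v i"
  by (erule finite_subset[rotated]) auto

global_interpretation qseq: vector_space qscale
  by standard (transfer; simp add: fun_eq_iff algebra_simps)+

definition proj_rel :: "qseq rel" where
  "proj_rel = {(v, w). v \<noteq> 0 \<and> w \<noteq> 0 \<and> (\<exists>c. c \<noteq> 0 \<and> w = qscale c v)}"

definition PFQ :: "qseq set set" where
  "PFQ = (UNIV - {0}) // proj_rel"

definition proj_point :: "qseq \<Rightarrow> qseq set" where
  "proj_point v = proj_rel `` {v}"

definition PFQ_nonneg :: "qseq set set" where
  "PFQ_nonneg = {P \<in> PFQ. \<exists>v\<in>P. \<forall>i. Poly_Mapping.lookup v i \<ge> 0}"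

definition proj_line :: "qseq set \<Rightarrow> qseq set \<Rightarrow> qseq set set" where
  "proj_line P Q = {proj_point v | v x y. x \<in> P \<and> y \<in> Q \<and> v \<in> qseq.span {x, y} \<and> v \<noteq> 0}"

lemma equiv_proj_rel: "equiv (UNIV - {0}) proj_rel"
proof (rule equivI)
  show "proj_rel \<subseteq> (UNIV - {0}) \<times> (UNIV - {0})"
    by (auto simp: proj_rel_def)
  show "refl_on (UNIV - {0}) proj_rel"
    by (auto simp: refl_on_def proj_rel_def intro!: exI[of _ 1])
  show "sym proj_rel"
  proof (rule symI)
    fix v w assume "(v, w) \<in> proj_rel"
    then obtain c where "v \<noteq> 0" "w \<noteq> 0" "c \<noteq> 0" "w = qscale c v"
      by (auto simp: proj_rel_def)
    then show "(w, v) \<in> proj_rel"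
      by (auto simp: proj_rel_def intro!: exI[of _ "inverse c"])
  qed
  show "trans proj_rel"
  proof (rule transI)
    fix u v w assume "(u, v) \<in> proj_rel" "(v, w) \<in> proj_rel"
    then obtain c d where "u \<noteq> 0" "w \<noteq> 0" "c \<noteq> 0" "d \<noteq> 0" "v = qscale c u" "w = qscale d v"
      by (auto simp: proj_rel_def)
    then show "(u, w) \<in> proj_rel"
      by (auto simp: proj_rel_def intro!: exI[of _ "d * c"])
  qed
qed

lemma infinite_primes: "infinite {p::nat. prime p}"
  by (rule primes_infinite)

lemma inj_nth_prime: "inj nth_prime"
  unfolding nth_prime_def by (rule inj_enumerate[OF infinite_primes])

lemma prime_nth_prime: "prime (nth_prime i)"
  using enumerate_in_set[OF infinite_primes, of i] by (simp add: nth_prime_def)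

lift_definition exponents :: "nat \<Rightarrow> qseq" is "\<lambda>g i. of_nat (multiplicity (nth_prime i) g)"
proof -
  fix g :: nat
  have "{i. of_nat (multiplicity (nth_prime i) g) \<noteq> (0::rat)} \<subseteq> nth_prime -` prime_factors g"
    using prime_nth_prime by (auto simp: prime_factors_multiplicity)
  moreover have "finite (nth_prime -` prime_factors g)"
    by (rule finite_vimageI[OF _ inj_nth_prime]) simp
  ultimately show "finite {i. of_nat (multiplicity (nth_prime i) g) \<noteq> (0::rat)}"
    by (rule finite_subset)
qed

definition point_of_nat :: "nat \<Rightarrow> qseq set" where
  "point_of_nat g = proj_point (exponents g)"

definition primitive_rep :: "qseq set \<Rightarrow> (nat \<Rightarrow>\<^sub>0 nat) \<Rightarrow> bool" where
  "primitive_rep P r \<longleftrightarrow>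
     Poly_Mapping.map of_nat r \<in> P \<and> Gcd (range (Poly_Mapping.lookup r)) = 1"

definition nat_of_point :: "qseq set \<Rightarrow> nat" where
  "nat_of_point P =
     (let r = (THE r. primitive_rep P r)
      in \<Prod>i\<in>Poly_Mapping.keys r. nth_prime i ^ Poly_Mapping.lookup r i)"

text \<open>The definite description above is well defined for points of \<^const>\<open>PFQ_nonneg\<close>.\<close>

lemma lookup_map_of_nat:
  "Poly_Mapping.lookup (Poly_Mapping.map of_nat r) i = (of_nat (Poly_Mapping.lookup r i) :: rat)"
  by transfer (simp add: when_def)

lemma ex1_primitive_rep:
  assumes "P \<in> PFQ_nonneg"
  shows "\<exists>!r. primitive_rep P r"
proof (rule ex_ex1I)
  obtain v where v: "v \<in> P" and nn: "\<And>i. Poly_Mapping.lookup v i \<ge> 0" and P: "P \<in> PFQ"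
    using assms by (auto simp: PFQ_nonneg_def)
  have v0: "v \<noteq> 0" and inP: "\<And>c. c \<noteq> 0 \<Longrightarrow> qscale c v \<in> P"
  proof -
    from P obtain x where x: "P = proj_rel `` {x}" by (auto simp: PFQ_def quotient_def)
    then show v0: "v \<noteq> 0" using v by (auto simp: proj_rel_def)
    fix c :: rat assume "c \<noteq> 0"
    then have "(v, qscale c v) \<in> proj_rel" using v0 by (auto simp: proj_rel_def)
    then show "qscale c v \<in> P"
      using v x equiv_proj_rel by (metis Image_singleton_iff equivE transD)
  qed
  let ?K = "Poly_Mapping.keys v"
  define d where "d = (\<Prod>i\<in>?K. snd (quotient_of (Poly_Mapping.lookup v i)))"
  have d0: "d > 0" unfolding d_def by (intro prod_pos) (simp add: quotient_of_denom_pos')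
  have "\<exists>m::nat. of_int d * Poly_Mapping.lookup v i = of_nat m" for i
  proof (cases "i \<in> ?K")
    case True
    obtain a b where ab: "quotient_of (Poly_Mapping.lookup v i) = (a, b)" by fastforce
    then have "b dvd d" unfolding d_def using True
      by (metis dvd_prodI finite_keys snd_conv)
    then obtain e where e: "d = b * e" by auto
    have b: "b > 0" and eq: "Poly_Mapping.lookup v i = of_int a / of_int b"
      using ab by (simp_all add: quotient_of_denom_pos quotient_of_div)
    have "of_int d * Poly_Mapping.lookup v i = of_int (e * a)" using b by (simp add: e eq)
    moreover have "of_int d * Poly_Mapping.lookup v i \<ge> 0" using nn d0 by simp
    ultimately have "of_int d * Poly_Mapping.lookup v i = of_nat (nat (e * a))"
      by (metis of_int_0_le_iff of_nat_nat)
    then show ?thesis ..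
  next
    case False
    then show ?thesis by (intro exI[of _ 0]) (simp add: in_keys_iff)
  qed
  then obtain m :: "nat \<Rightarrow> nat" where m: "\<And>i. of_int d * Poly_Mapping.lookup v i = of_nat (m i)"
    by metis
  define g where "g = Gcd (range m)"
  have gd: "g dvd m i" for i by (simp add: g_def Gcd_dvd)
  have g0: "g \<noteq> 0"
  proof
    assume "g = 0"
    then have "Poly_Mapping.lookup v i = 0" for i using gd[of i] m[of i] d0 by simp
    then show False using v0 by (simp add: poly_mapping_eqI)
  qed
  define s where "s = (\<lambda>i. m i div g)"
  have ms: "m i = g * s i" for i using gd by (simp add: s_def)
  have "{i. s i \<noteq> 0} \<subseteq> ?K"
  proof
    fix i assume "i \<in> {i. s i \<noteq> 0}"
    then have "m i \<noteq> 0" using ms g0 by simp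
    then show "i \<in> ?K" using m[of i] by (auto simp: in_keys_iff)
  qed
  then have "finite {i. s i \<noteq> 0}" by (rule finite_subset) simp
  then have look: "Poly_Mapping.lookup (Abs_poly_mapping s) = s" by simp
  have "g = g * Gcd (range s)"
  proof -
    have "range m = (*) g ` range s" using ms by (auto simp: image_def)
    then show ?thesis by (metis Gcd_mult g_def normalize_nat_def id_apply)
  qed
  then have "Gcd (range s) = 1" using g0 by simp
  moreover have "Poly_Mapping.map of_nat (Abs_poly_mapping s) = qscale (of_int d / of_nat g) v"
    using g0 by (intro poly_mapping_eqI)
      (simp add: lookup_map_of_nat look qscale.rep_eq m ms)
  ultimately show "\<exists>r. primitive_rep P r"
    using d0 g0 inP look by (intro exI[of _ "Abs_poly_mapping s"]) (simp add: primitive_rep_def)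
next
  fix r s assume r: "primitive_rep P r" and s: "primitive_rep P s"
  let ?r = "Poly_Mapping.lookup r" and ?s = "Poly_Mapping.lookup s"
  have "P \<in> PFQ" using assms by (simp add: PFQ_nonneg_def)
  then have "(Poly_Mapping.map of_nat r, Poly_Mapping.map of_nat s) \<in> proj_rel"
    using r s quotient_eq_iff[OF equiv_proj_rel] unfolding PFQ_def primitive_rep_def by blast
  then obtain c where c: "c \<noteq> 0" "Poly_Mapping.map of_nat s = qscale c (Poly_Mapping.map of_nat r)"
    by (auto simp: proj_rel_def)
  have eq: "of_nat (?s i) = c * of_nat (?r i)" for i
    using arg_cong[OF c(2), of "\<lambda>u. Poly_Mapping.lookup u i"]
    by (simp add: lookup_map_of_nat qscale.rep_eq)
  have "c > 0"
  proof -
    have "\<exists>i. ?r i \<noteq> 0"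
    proof (rule ccontr)
      assume "\<nexists>i. ?r i \<noteq> 0"
      then have "range ?r = {0}" by auto
      then show False using r by (simp add: primitive_rep_def)
    qed
    then obtain i where "?r i \<noteq> 0" by blast
    moreover have "c * of_nat (?r i) \<ge> 0" using eq[of i] by (metis of_nat_0_le_iff)
    ultimately show ?thesis using c(1) by (simp add: zero_le_mult_iff)
  qed
  obtain a b where ab: "quotient_of c = (a, b)" by fastforce
  then have b: "b > 0" and cab: "c = of_int a / of_int b"
    by (simp_all add: quotient_of_denom_pos quotient_of_div)
  then have a: "a > 0" using \<open>c > 0\<close> by (simp add: zero_less_divide_iff)
  have nat_eq: "nat b * ?s i = nat a * ?r i" for i
  proof -
    have "of_int b * of_nat (?s i) = (of_int a * of_nat (?r i) :: rat)"
      using b by (simp add: eq cab)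
    then have "b * int (?s i) = a * int (?r i)"
      by (metis of_int_eq_iff of_int_mult of_int_of_nat_eq)
    then show ?thesis using a b by (metis int_nat_eq less_imp_le nat_int of_nat_mult)
  qed
  then have "(*) (nat b) ` range ?s = (*) (nat a) ` range ?r"
    by (simp add: image_image)
  then have "nat b * Gcd (range ?s) = nat a * Gcd (range ?r)"
    by (metis Gcd_mult normalize_nat_def id_apply)
  then have "nat b = nat a" using r s by (simp add: primitive_rep_def)
  then have "?s i = ?r i" for i using nat_eq[of i] a b by simp
  then show "r = s" by (metis poly_mapping_eqI)
qed

definition mult_closed_gen :: "nat \<Rightarrow> (nat \<Rightarrow> nat) \<Rightarrow> nat set" where
  "mult_closed_gen r g = {\<Prod>k=1..r. g k ^ e k | e. True}"

definition doubly_generated :: "nat set \<Rightarrow> bool" where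
  "doubly_generated T \<longleftrightarrow> (\<exists>u v. u > 0 \<and> v > 0 \<and> T = {u ^ i * v ^ j | i j. True})"

end

theory Submission
  imports Defs
begin

text \<open>
  Let \<open>a\<close> and \<open>b\<close> be the primitive integral representatives of \<open>P\<close> and \<open>Q\<close>, and let \<open>u\<close> and \<open>v\<close> be
  the corresponding integers. Coprimality of \<open>u\<close> and \<open>v\<close> means that \<open>a\<close> and \<open>b\<close> have disjoint
  supports, so if the exponent vector of \<open>g\<close> is \<open>x a + y b\<close> with rational \<open>x\<close> and \<open>y\<close>, then all
  entries of \<open>x a\<close> and of \<open>y b\<close> are natural numbers. Since the entries of \<open>a\<close> have gcd \<open>1\<close>, and
  likewise those of \<open>b\<close>, both \<open>x\<close> and \<open>y\<close> are natural numbers, and \<open>g = u\<^sup>x v\<^sup>y\<close>.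
\<close>

lemma ex_nth_prime:
  assumes "prime p"
  shows "\<exists>i. p = nth_prime i"
  using enumerate_Ex[OF infinite_primes, of p] assms by (auto simp: nth_prime_def)

lemma multiplicity_prod_nth_prime_powers:
  assumes "finite A"
  shows "multiplicity (nth_prime j) (\<Prod>i\<in>A. nth_prime i ^ f i) = (if j \<in> A then f j else 0)"
proof -
  have inj: "inj_on nth_prime A"
    using inj_nth_prime by (rule inj_on_subset) simp
  \<comment> \<open>Reindexing by the primes themselves, with exponent
    \<open>f (inv nth_prime p)\<close>, brings the product into the shape of
    \<open>multiplicity_prod_prime_powers\<close>.\<close>
  have "(\<Prod>i\<in>A. nth_prime i ^ f i) = (\<Prod>p\<in>nth_prime ` A. p ^ f (inv nth_prime p))"
    using inj by (simp add: prod.reindex inv_f_f[OF inj_nth_prime])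
  also have "multiplicity (nth_prime j) \<dots> =
      (if nth_prime j \<in> nth_prime ` A then f (inv nth_prime (nth_prime j)) else 0)"
    using assms by (intro multiplicity_prod_prime_powers) (auto simp: prime_nth_prime)
  finally show ?thesis
    by (simp add: inv_f_f[OF inj_nth_prime] inj_image_mem_iff[OF inj_nth_prime])
qed

text \<open>No condition on \<open>P\<close> appears: whatever \<open>THE\<close> returns, the value
  is a product of prime powers.\<close>

lemma nat_of_point_pos: "nat_of_point P > 0"
  by (auto simp: nat_of_point_def Let_def prime_gt_0_nat[OF prime_nth_prime] intro!: prod_pos)

lemma primitive_rep_multiplicity_nat_of_point:
  assumes "P \<in> PFQ_nonneg" "primitive_rep P a"
  shows "multiplicity (nth_prime i) (nat_of_point P) = Poly_Mapping.lookup a i"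
proof -
  have "(THE r. primitive_rep P r) = a"
    using ex1_primitive_rep[OF assms(1)] assms(2) by (rule the1_equality)
  then show ?thesis
    by (simp add: nat_of_point_def multiplicity_prod_nth_prime_powers in_keys_iff)
qed

lemma PFQ_mem_scale:
  assumes "P \<in> PFQ" "v \<in> P" "w \<in> P"
  shows "\<exists>c. w = qscale c v"
proof -
  have "(v, w) \<in> proj_rel"
    using assms quotient_eq_iff[OF equiv_proj_rel] unfolding PFQ_def by blast
  then show ?thesis by (auto simp: proj_rel_def)
qed

text \<open>The representatives \<open>x\<close>, \<open>y\<close> in \<open>proj_line\<close> may
  vary, but each is a multiple of the fixed \<open>a\<close> or \<open>b\<close>. So the span stays
  inside that of \<open>a\<close> and \<open>b\<close>, and rescaling the spanned vector gives
  \<open>w\<close> itself.\<close>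

lemma proj_line_combination:
  assumes "P \<in> PFQ" "Q \<in> PFQ" "a \<in> P" "b \<in> Q" "proj_point w \<in> proj_line P Q"
  shows "\<exists>s t. w = qscale s a + qscale t b"
proof -
  obtain v x y where v: "proj_point w = proj_point v" "v \<noteq> 0" "v \<in> qseq.span {x, y}"
    and xy: "x \<in> P" "y \<in> Q"
    using assms(5) by (auto simp: proj_line_def)
  \<comment> \<open>Being nonzero, \<open>v\<close> lies in its own class, which is also the class
    of \<open>w\<close>.\<close>
  have "(v, v) \<in> proj_rel"
    using v(2) by (auto simp: proj_rel_def intro!: exI[of _ 1])
  then have "(w, v) \<in> proj_rel"
    using v(1) by (auto simp: proj_point_def)
  then obtain c where c: "c \<noteq> 0" "v = qscale c w"
    by (auto simp: proj_rel_def)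
  obtain d where d: "x = qscale d a"
    using PFQ_mem_scale[OF assms(1,3) xy(1)] by blast
  obtain e where e: "y = qscale e b"
    using PFQ_mem_scale[OF assms(2,4) xy(2)] by blast
  have "{x, y} \<subseteq> qseq.span {a, b}"
    unfolding d e by (auto intro: qseq.span_scale qseq.span_base)
  then have "v \<in> qseq.span {a, b}"
    using v(3) qseq.span_minimal[OF _ qseq.subspace_span] by blast
  then have "qscale (inverse c) v \<in> qseq.span {a, b}"
    by (rule qseq.span_scale)
  then have "w \<in> qseq.span {a, b}"
    using c by simp
  then obtain s t where "w - qscale s a = qscale t b"
    by (auto simp: qseq.span_insert qseq.span_singleton)
  then have "w = qscale s a + qscale t b"
    by (simp add: algebra_simps)
  then show ?thesis by blast
qed

text \<open>If \<open>c = p/q\<close> in lowest terms, integrality of each \<open>c * f j\<close>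
  forces \<open>q\<close> to divide \<open>f j\<close>. Hence \<open>q\<close> divides the gcd, so
  \<open>q = 1\<close>.\<close>

lemma rat_is_nat_if_Gcd_multiples:
  fixes c :: rat and f :: "nat \<Rightarrow> nat"
  assumes gcd: "Gcd (range f) = 1" and mult: "\<And>i. c * of_nat (f i) \<in> \<nat>"
  shows "c \<in> \<nat>"
proof -
  have "\<forall>i. \<exists>n. c * of_nat (f i) = of_nat n"
    using mult by (blast elim: Nats_cases)
  from choice[OF this] obtain m where m: "\<And>i. c * of_nat (f i) = of_nat (m i)"
    by blast
  \<comment> \<open>The gcd of an all-zero family is 0, so some entry is positive; its multiple by
    \<open>c\<close> is a natural number, which fixes the sign of \<open>c\<close>.\<close>
  have "f \<noteq> (\<lambda>_. 0)" using gcd by auto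
  then obtain i where i: "f i \<noteq> 0" by (auto simp: fun_eq_iff)
  have "c * of_nat (f i) \<ge> 0" by (simp add: m)
  then have c0: "c \<ge> 0" using i by (simp add: zero_le_mult_iff)
  obtain p q where pq: "quotient_of c = (p, q)" by fastforce
  then have q: "q > 0" and cpq: "c = of_int p / of_int q" and cop: "coprime p q"
    by (simp_all add: quotient_of_denom_pos quotient_of_div quotient_of_coprime)
  have "nat q dvd f j" for j
  proof -
    have "(of_int (p * int (f j)) :: rat) = of_int (q * int (m j))"
      using m[of j] q by (simp add: cpq field_simps)
    then have "q dvd p * int (f j)" by (metis dvd_triv_left of_int_eq_iff)
    then have "q dvd int (f j)" using cop by (simp add: coprime_commute coprime_dvd_mult_right_iff)
    then show ?thesis using q by (simp add: nat_dvd_iff)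
  qed
  then have "nat q dvd Gcd (range f)" by (auto intro: Gcd_greatest)
  then have "q = 1" using gcd q by simp
  then have "c = of_nat (nat p)" using c0 cpq by simp
  then show ?thesis by simp
qed

lemma point_on_line_factorization:
  assumes P: "P \<in> PFQ_nonneg" and Q: "Q \<in> PFQ_nonneg"
    and coprime: "coprime (nat_of_point P) (nat_of_point Q)"
    and g: "g > 0" and line: "point_of_nat g \<in> proj_line P Q"
  shows "\<exists>m n. g = nat_of_point P ^ m * nat_of_point Q ^ n"
proof -
  let ?u = "nat_of_point P" and ?v = "nat_of_point Q"
  obtain a b where a: "primitive_rep P a" and b: "primitive_rep Q b"
    using ex1_primitive_rep[OF P] ex1_primitive_rep[OF Q] by blast
  let ?a = "Poly_Mapping.lookup a" and ?b = "Poly_Mapping.lookup b"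
  note mu = primitive_rep_multiplicity_nat_of_point[OF P a]
  note mv = primitive_rep_multiplicity_nat_of_point[OF Q b]
  obtain s t where st: "exponents g =
      qscale s (Poly_Mapping.map of_nat a) + qscale t (Poly_Mapping.map of_nat b)"
    using proj_line_combination[of P Q _ _ "exponents g"] P Q a b line
    unfolding PFQ_nonneg_def primitive_rep_def point_of_nat_def by blast
  have eq: "of_nat (multiplicity (nth_prime i) g) = s * of_nat (?a i) + t * of_nat (?b i)" for i
    using arg_cong[OF st, of "\<lambda>w. Poly_Mapping.lookup w i"]
    by (simp add: lookup_add qscale.rep_eq lookup_map_of_nat exponents.rep_eq)
  \<comment> \<open>An index in both supports would give a prime dividing both integers.\<close>
  have disj: "?a i = 0 \<or> ?b i = 0" for i
  proof (rule ccontr)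
    assume "\<not> ?thesis"
    then have "nth_prime i dvd ?u" "nth_prime i dvd ?v"
      using not_dvd_imp_multiplicity_0[of "nth_prime i"] mu[of i] mv[of i] by force+
    then show False
      using coprime prime_nth_prime[of i] by (meson coprime_common_divisor not_prime_unit)
  qed
  \<comment> \<open>At each index one summand of \<open>eq\<close> vanishes, so the other equals a
    multiplicity of \<open>g\<close>.\<close>
  have nats: "s * of_nat (?a i) \<in> \<nat> \<and> t * of_nat (?b i) \<in> \<nat>" for i
    using disj[of i] eq[of i, symmetric] by auto
  have "s \<in> \<nat>" "t \<in> \<nat>"
    using rat_is_nat_if_Gcd_multiples[of ?a s] rat_is_nat_if_Gcd_multiples[of ?b t] nats a b
    unfolding primitive_rep_def by auto
  then obtain m n where "s = of_nat m" "t = of_nat n"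
    by (elim Nats_cases)
  then have "(of_nat (multiplicity (nth_prime i) g) :: rat) = of_nat (m * ?a i + n * ?b i)" for i
    using eq[of i] by simp
  then have mult: "multiplicity (nth_prime i) g = m * ?a i + n * ?b i" for i
    using of_nat_eq_iff by blast
  \<comment> \<open>Both sides are positive, so it suffices to compare multiplicities at every
    prime, and every prime is some \<open>nth_prime i\<close>.\<close>
  have "g = ?u ^ m * ?v ^ n"
  proof (rule multiplicity_eq_nat)
    fix p :: nat assume p: "prime p"
    then obtain i where "p = nth_prime i" using ex_nth_prime by blast
    then show "multiplicity p g = multiplicity p (?u ^ m * ?v ^ n)"
      using p nat_of_point_pos[of P] nat_of_point_pos[of Q]
      by (simp add: mult mu mv prime_elem_multiplicity_mult_distrib
          prime_elem_multiplicity_power_distrib)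
  qed (use g nat_of_point_pos[of P] nat_of_point_pos[of Q] in auto)
  then show ?thesis by blast
qed

theorem theorem7p8:
  fixes r :: nat and g :: "nat \<Rightarrow> nat" and P Q :: "qseq set" and L :: "qseq set set"
  assumes g_gt_1: "\<And>k. k \<in> {1..r} \<Longrightarrow> g k > 1"
    and P: "P \<in> PFQ_nonneg"
    and Q: "Q \<in> PFQ_nonneg"
    and distinct: "P \<noteq> Q"
    and rel_prime: "coprime (nat_of_point P) (nat_of_point Q)"
    and L: "L = proj_line P Q"
    and on_line: "\<And>k. k \<in> {1..r} \<Longrightarrow> point_of_nat (g k) \<in> L"
  shows "\<exists>T. doubly_generated T \<and> mult_closed_gen r g \<subseteq> T"
proof -
  let ?u = "nat_of_point P" and ?v = "nat_of_point Q"
  have "\<exists>m n. g k = ?u ^ m * ?v ^ n" if "k \<in> {1..r}" for k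
    using g_gt_1[OF that] on_line[OF that] unfolding L
    by (intro point_on_line_factorization[OF P Q rel_prime]) simp_all
  then have "\<forall>k\<in>{1..r}. \<exists>m n. g k = ?u ^ m * ?v ^ n"
    by blast
  then obtain m n where mn: "\<And>k. k \<in> {1..r} \<Longrightarrow> g k = ?u ^ m k * ?v ^ n k"
    unfolding bchoice_iff by blast
  \<comment> \<open>The same \<open>u\<close> and \<open>v\<close> serve all generators, so the
    exponents simply add up.\<close>
  have "(\<Prod>k=1..r. g k ^ e k) = ?u ^ (\<Sum>k=1..r. m k * e k) * ?v ^ (\<Sum>k=1..r. n k * e k)" for e
  proof -
    have "(\<Prod>k=1..r. g k ^ e k) = (\<Prod>k=1..r. ?u ^ (m k * e k) * ?v ^ (n k * e k))"
      by (rule prod.cong) (simp_all add: mn power_mult_distrib power_mult)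
    then show ?thesis by (simp add: prod.distrib power_sum)
  qed
  then have "mult_closed_gen r g \<subseteq> {?u ^ i * ?v ^ j | i j. True}"
    unfolding mult_closed_gen_def by blast
  moreover have "doubly_generated {?u ^ i * ?v ^ j | i j. True}"
    unfolding doubly_generated_def using nat_of_point_pos by blast
  ultimately show ?thesis by blast
qed

end
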